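(* Let $K$ be a field, let $\mathcal{C}$ be a clutter and let $\mathcal{C}'$ be a parallelization of $\mathcal{C}$. If the edge ideal $I(\mathcal{C})$ is normally torsion free, then the edge ideal $I(\mathcal{C}')$ is normally torsion free.
   Context: A clutter $\mathcal{C}$ with finite vertex set $V(\mathcal{C})=X=\{x_1,\ldots,x_n\}$ is a family $E(\mathcal{C})$ of subsets of $X$ (edges), none of which is included in another. Standing assumption on the initial clutter $\mathcal{C}$: $n\geq 1$ and each vertex lies in at least one edge (so all edges are nonempty). The vertices are identified with indeterminates. The edge ideal $I(\mathcal{C})$ is the ideal of the polynomial ring $K[V(\mathcal{C})]$ generated by the square-free monomials $\prod_{x_i\in e}x_i$, $e\in E(\mathcal{C})$ (the zero ideal if there are no edges). Duplicating a vertex $x_i$ means extending the vertex set by a new vertex $x_i'$ and replacing $E(\mathcal{C})$ by $E(\mathcal{C})\cup\{(e\setminus\{x_i\})\cup\{x_i'\} \mid x_i\in e\in E(\mathcal{C})\}$. Deleting a vertex $x_i$ means removing $x_i$ from the vertex set and removing all edges containing $x_i$. A parallelization of $\mathcal{C}$ is a clutter obtained from $\mathcal{C}$ by a sequence of deletions and duplications of vertices. The ideal $I=I(\mathcal{C})$ is called normally torsion free if $I^i=I^{(i)}$ for all $i\geq 1$, where $I^{(i)}$ is the $i$-th symbolic power of $I$; for a square-free monomial ideal $I$ with minimal primes $\mathfrak{p}_1,\ldots,\mathfrak{p}_s$ one has $I^{(i)}=\mathfrak{p}_1^i\cap\cdots\cap\mathfrak{p}_s^i$. *)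

theory Defs
  imports "HOL-Algebra.Ideal_Product" "HOL-Library.Poly_Mapping"
begin

section \<open>Clutters and parallelizations\<close>

record 'v hypergraph =
  verts :: "'v set"
  edges :: "'v set set"

definition clutter :: "'v hypergraph \<Rightarrow> bool" where
  "clutter C \<longleftrightarrow> finite (verts C) \<and> edges C \<subseteq> Pow (verts C) \<and>
     (\<forall>e\<in>edges C. \<forall>f\<in>edges C. e \<subseteq> f \<longrightarrow> e = f)"

text \<open>These requirements concern the initial clutter only: deletions may create isolated
  vertices and may even remove all vertices.\<close>

definition initial_clutter :: "'v hypergraph \<Rightarrow> bool" where
  "initial_clutter C \<longleftrightarrow> clutter C \<and> verts C \<noteq> {} \<and> (\<forall>x\<in>verts C. \<exists>e\<in>edges C. x \<in> e)"

definition duplicate :: "'v \<Rightarrow> 'v \<Rightarrow> 'v hypergraph \<Rightarrow> 'v hypergraph" where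
  "duplicate x x' C =
     \<lparr>verts = insert x' (verts C),
      edges = edges C \<union> {insert x' (e - {x}) | e. e \<in> edges C \<and> x \<in> e}\<rparr>"

definition delete :: "'v \<Rightarrow> 'v hypergraph \<Rightarrow> 'v hypergraph" where
  "delete x C = \<lparr>verts = verts C - {x}, edges = {e \<in> edges C. x \<notin> e}\<rparr>"

text \<open>The name \<open>x'\<close> of the new vertex in a duplication is any element of the vertex type that
  is not currently a vertex.\<close>

inductive parallelization :: "'v hypergraph \<Rightarrow> 'v hypergraph \<Rightarrow> bool" for C where
  refl: "parallelization C C"
| duplicate: "parallelization C D \<Longrightarrow> x \<in> verts D \<Longrightarrow> x' \<notin> verts D \<Longrightarrow>
    parallelization C (duplicate x x' D)"
| delete: "parallelization C D \<Longrightarrow> x \<in> verts D \<Longrightarrow> parallelization C (delete x D)"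

lemma clutter_duplicate:
  assumes "clutter C" "x \<in> verts C" "x' \<notin> verts C"
  shows "clutter (duplicate x x' C)"
proof -
  have V: "e \<subseteq> verts C" if "e \<in> edges C" for e
    using assms(1) that by (auto simp: clutter_def)
  have A: "e = f" if "e \<in> edges C" "f \<in> edges C" "e \<subseteq> f" for e f
    using assms(1) that by (auto simp: clutter_def)
  have F: "x' \<notin> e" if "e \<in> edges C" for e
    using V[OF that] assms(3) by auto
  have "e = f" if e: "e \<in> edges (duplicate x x' C)" and f: "f \<in> edges (duplicate x x' C)"
    and ef: "e \<subseteq> f" for e f
  proof (cases "e \<in> edges C")
    case e1: True
    show ?thesis
    proof (cases "f \<in> edges C")
      case True
      then show ?thesis using A e1 ef by blast
    next
      case False
      then obtain g where g: "g \<in> edges C" "x \<in> g" "f = insert x' (g - {x})"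
        using f by (auto simp: duplicate_def)
      then have "e \<subseteq> g" using ef F[OF e1] by auto
      then have "e = g" using A e1 g(1) by blast
      then show ?thesis using ef g assms by auto
    qed
  next
    case False
    then obtain g where g: "g \<in> edges C" "x \<in> g" "e = insert x' (g - {x})"
      using e by (auto simp: duplicate_def)
    then have "x' \<in> f" using ef by auto
    then have "f \<notin> edges C" using F by blast
    then obtain h where h: "h \<in> edges C" "x \<in> h" "f = insert x' (h - {x})"
      using f by (auto simp: duplicate_def)
    have "g \<subseteq> h" using ef g h F[OF g(1)] by auto
    then have "g = h" using A g h by blast
    then show ?thesis using g h by simp
  qed
  moreover have "edges (duplicate x x' C) \<subseteq> Pow (verts (duplicate x x' C))"
    using V by (fastforce simp: duplicate_def)
  moreover have "finite (verts (duplicate x x' C))"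
    using assms(1) by (simp add: clutter_def duplicate_def)
  ultimately show ?thesis
    unfolding clutter_def by blast
qed

lemma clutter_delete: "clutter C \<Longrightarrow> clutter (delete x C)"
  by (auto simp: clutter_def delete_def)

lemma clutter_parallelization:
  assumes "parallelization C D" "clutter C"
  shows "clutter D"
  using assms by induction (auto intro: clutter_duplicate clutter_delete)


section \<open>Edge ideals\<close>

text \<open>A polynomial is a finitely supported map from monomials to coefficients, a monomial being a
  finitely supported map from variables to exponents. \<open>polynomial_ring V\<close> is $K[V]$.\<close>

type_synonym ('v, 'k) mpoly = "('v \<Rightarrow>\<^sub>0 nat) \<Rightarrow>\<^sub>0 'k"

definition polynomial_ring :: "'v set \<Rightarrow> ('v, 'k::field) mpoly ring" where
  "polynomial_ring V =
     \<lparr>carrier = {p. \<forall>m \<in> Poly_Mapping.keys p. Poly_Mapping.keys m \<subseteq> V},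
      mult = (*), one = 1, zero = 0, add = (+)\<rparr>"

definition var :: "'v \<Rightarrow> ('v, 'k::field) mpoly" where
  "var x = Poly_Mapping.single (Poly_Mapping.single x 1) 1"

definition edge_ideal :: "'v hypergraph \<Rightarrow> ('v, 'k::field) mpoly set" where
  "edge_ideal C = Idl\<^bsub>polynomial_ring (verts C)\<^esub> ((\<lambda>e. \<Prod>x\<in>e. var x) ` edges C)"

lemma cring_polynomial_ring: "cring (polynomial_ring V)"
proof -
  have add: "p + q \<in> carrier (polynomial_ring V)"
    if "p \<in> carrier (polynomial_ring V)" "q \<in> carrier (polynomial_ring V)"
    for p q :: "('a, 'b) mpoly"
    using that keys_add[of p q] by (fastforce simp: polynomial_ring_def)
  have mult: "p * q \<in> carrier (polynomial_ring V)"
    if "p \<in> carrier (polynomial_ring V)" "q \<in> carrier (polynomial_ring V)"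
    for p q :: "('a, 'b) mpoly"
    unfolding polynomial_ring_def
  proof clarsimp
    fix m x assume "m \<in> Poly_Mapping.keys (p * q)" and x: "x \<in> Poly_Mapping.keys m"
    then obtain a b where "a \<in> Poly_Mapping.keys p" "b \<in> Poly_Mapping.keys q" "m = a + b"
      using keys_mult[of p q] by blast
    with x that show "x \<in> V"
      using keys_add[of a b] by (fastforce simp: polynomial_ring_def)
  qed
  have neg: "- p \<in> carrier (polynomial_ring V)"
    if "p \<in> carrier (polynomial_ring V)" for p :: "('a, 'b) mpoly"
    using that by (auto simp: polynomial_ring_def in_keys_iff)
  have ops: "mult (polynomial_ring V) = (*)" "one (polynomial_ring V) = 1"
    "zero (polynomial_ring V) = 0" "add (polynomial_ring V) = (+)"
    for V :: "'a set"
    by (simp_all add: polynomial_ring_def)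
  have zero_one: "0 \<in> carrier (polynomial_ring V)" "1 \<in> carrier (polynomial_ring V)"
    by (simp_all add: polynomial_ring_def)
  have "abelian_group (polynomial_ring V :: ('a, 'b) mpoly ring)"
  proof (rule abelian_groupI, unfold ops)
    show "\<exists>q\<in>carrier (polynomial_ring V). q + p = 0"
      if "p \<in> carrier (polynomial_ring V)" for p :: "('a, 'b) mpoly"
      using neg[OF that] by (intro bexI[of _ "- p"]) simp_all
  qed (rule add zero_one add.assoc add.commute add_0_left; assumption)+
  moreover have "comm_monoid (polynomial_ring V :: ('a, 'b) mpoly ring)"
    by (rule comm_monoidI, unfold ops)
      (rule mult zero_one mult.assoc mult.commute mult_1_left; assumption)+
  ultimately show ?thesis
    by (rule cringI) (simp add: ops distrib_right)
qed


section \<open>Symbolic powers\<close>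

definition minimal_prime :: "('a, 'b) ring_scheme \<Rightarrow> 'a set \<Rightarrow> 'a set \<Rightarrow> bool" where
  "minimal_prime R I P \<longleftrightarrow> primeideal P R \<and> I \<subseteq> P \<and>
     (\<forall>Q. primeideal Q R \<and> I \<subseteq> Q \<and> Q \<subseteq> P \<longrightarrow> Q = P)"

abbreviation ideal_power :: "('a, 'b) ring_scheme \<Rightarrow> 'a set \<Rightarrow> nat \<Rightarrow> 'a set" where
  "ideal_power R I i \<equiv> I [^]\<^bsub>ideals_set R\<^esub> i"

text \<open>For every minimal prime \<open>P\<close> of \<open>I\<close>, the elements \<open>r\<close> such that \<open>s r\<close> lies in $I^i$ for
  some \<open>s\<close> outside \<open>P\<close> form the contraction to \<open>R\<close> of the localization of $I^i$ at \<open>P\<close>, that is,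
  the \<open>P\<close>-primary component of $I^i$. The symbolic power is the intersection of these
  components. For a square-free monomial ideal the component at \<open>P\<close> is $P^i$.\<close>

definition symbolic_power :: "('a, 'b) ring_scheme \<Rightarrow> 'a set \<Rightarrow> nat \<Rightarrow> 'a set" where
  "symbolic_power R I i =
     {r \<in> carrier R. \<forall>P. minimal_prime R I P \<longrightarrow>
        (\<exists>s \<in> carrier R - P. s \<otimes>\<^bsub>R\<^esub> r \<in> ideal_power R I i)}"

definition normally_torsion_free :: "('a, 'b) ring_scheme \<Rightarrow> 'a set \<Rightarrow> bool" where
  "normally_torsion_free R I \<longleftrightarrow> (\<forall>i\<ge>1. ideal_power R I i = symbolic_power R I i)"

end

theory Submission
  imports Defs
begin

text \<open>Normal torsion-freeness of the edge ideal is a packing property of monomials: if every vertex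
  cover of the clutter has weight at least \<open>i\<close> under an exponent vector \<open>m\<close>, then the monomial
  with exponents \<open>m\<close> is divisible by a product of \<open>i\<close> edges. Indeed both the powers and the
  symbolic powers are spanned by monomials, and the minimal primes are generated by the minimal
  vertex covers. The packing property does not mention the field and visibly survives
  deletions (give the deleted vertex weight \<open>0\<close>) and duplications (give the original vertex the
  total weight of its two copies, then distribute the edges of the packing between them).\<close>

section \<open>Packing edges below a weight\<close>

text \<open>Membership of the monomial with exponents \<open>m\<close> in the \<open>i\<close>-th
  power of the edge ideal, freed from the ring. All of \<open>E\<close> stays available after each
  removal, so edges may repeat, and positivity on \<open>e\<close> keeps the truncated subtraction
  exact.\<close>

primrec packs :: "'v set set \<Rightarrow> nat \<Rightarrow> ('v \<Rightarrow> nat) \<Rightarrow> bool" where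
  "packs E 0 m = True"
| "packs E (Suc i) m =
     (\<exists>e\<in>E. (\<forall>v\<in>e. 0 < m v) \<and> packs E i (\<lambda>v. if v \<in> e then m v - 1 else m v))"

definition vertex_cover :: "'v hypergraph \<Rightarrow> 'v set \<Rightarrow> bool" where
  "vertex_cover C T \<longleftrightarrow> T \<subseteq> verts C \<and> (\<forall>e\<in>edges C. e \<inter> T \<noteq> {})"

definition minimal_cover :: "'v hypergraph \<Rightarrow> 'v set \<Rightarrow> bool" where
  "minimal_cover C T \<longleftrightarrow> vertex_cover C T \<and> (\<forall>S. vertex_cover C S \<and> S \<subseteq> T \<longrightarrow> S = T)"

text \<open>This is the max-flow min-cut (Mengerian) property: the obvious upper bound that a cover
  puts on the size of a packing is attained for every integral weight.\<close>

definition packing_property :: "'v hypergraph \<Rightarrow> bool" where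
  "packing_property C \<longleftrightarrow>
     (\<forall>i m. (\<forall>T. vertex_cover C T \<longrightarrow> i \<le> sum m T) \<longrightarrow> packs (edges C) i m)"

lemma packs_mono:
  assumes "packs E i m" "\<And>v. m v \<le> n v"
  shows "packs E i n"
  using assms
proof (induction i arbitrary: m n)
  case (Suc i)
  then obtain e where e: "e \<in> E" "\<forall>v\<in>e. 0 < m v"
    "packs E i (\<lambda>v. if v \<in> e then m v - 1 else m v)"
    by auto
  have "packs E i (\<lambda>v. if v \<in> e then n v - 1 else n v)"
    by (rule Suc.IH[OF e(3)]) (simp add: Suc.prems(2) diff_le_mono)
  moreover have "\<forall>v\<in>e. 0 < n v"
    using e(2) Suc.prems(2) by (meson order_less_le_trans)
  ultimately show ?case
    using e(1) by auto
qed simp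

text \<open>Monotonicity in the form required by \<open>monomial_set_ideal\<close>: multiples of a
  monomial admit the same packings.\<close>

lemma mono_packs: "mono (packs E i)"
  by (intro monoI le_boolI) (erule packs_mono, simp add: le_fun_def)

text \<open>Two packings below \<open>m\<close> and \<open>n\<close> can be carried out one after
  the other. On monomials this is the inclusion of a product of powers in the power with the summed
  exponent.\<close>

lemma packs_add:
  assumes "packs E i m" "packs E j n"
  shows "packs E (i + j) (\<lambda>v. m v + n v)"
  using assms
proof (induction i arbitrary: m)
  case 0
  then show ?case by (auto intro: packs_mono)
next
  case (Suc i)
  then obtain e where e: "e \<in> E" "\<forall>v\<in>e. 0 < m v"
    "packs E i (\<lambda>v. if v \<in> e then m v - 1 else m v)"
    by auto
  have "packs E (i + j) (\<lambda>v. (if v \<in> e then m v - 1 else m v) + n v)"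
    using Suc e by blast
  \<comment> \<open>Since \<open>m\<close> is positive on \<open>e\<close>, the truncated
    subtraction can be moved past the summand \<open>n v\<close>.\<close>
  then have "packs E (i + j) (\<lambda>v. if v \<in> e then m v + n v - 1 else m v + n v)"
    by (rule packs_mono) (use e(2) in auto)
  then show ?case
    using e by auto
qed

lemma packs_le:
  assumes "packs E i m" "j \<le> i"
  shows "packs E j m"
  using assms
proof (induction j arbitrary: i m)
  case (Suc j)
  then obtain k where k: "i = Suc k" "j \<le> k"
    by (cases i) auto
  then obtain e where "e \<in> E" "\<forall>v\<in>e. 0 < m v"
    "packs E k (\<lambda>v. if v \<in> e then m v - 1 else m v)"
    using Suc.prems by auto
  then show ?case
    using Suc.IH k by auto
qed simp

lemma packs_edge: "e \<in> E \<Longrightarrow> packs E k (\<lambda>v. if v \<in> e then k else 0)"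
proof (induction k)
  case (Suc k)
  have "packs E k (\<lambda>v. if v \<in> e then (if v \<in> e then Suc k else 0) - 1
      else (if v \<in> e then Suc k else 0))"
    by (rule packs_mono[OF Suc.IH[OF Suc.prems]]) simp
  then show ?case
    using Suc.prems by auto
qed simp

text \<open>Each \<open>x\<close> in \<open>T\<close> contributes \<open>m x\<close> copies of its
  own edge \<open>e x\<close>. The intended edges are those meeting a minimal cover \<open>T\<close>
  in \<open>x\<close> alone.\<close>

lemma packs_family:
  assumes "finite T" "\<And>x. x \<in> T \<Longrightarrow> e x \<in> E"
  shows "packs E (sum m T) (\<lambda>v. \<Sum>x\<in>T. if v \<in> e x then m x else 0)"
  using assms
proof (induction T rule: finite_induct)
  case (insert x T)
  then show ?case
    using packs_add[OF packs_edge[of "e x" E "m x"]] by simp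
qed simp

text \<open>Weak duality: every edge of the packing consumes at least one unit of weight on
  \<open>T\<close>.\<close>

lemma packs_le_sum_cover:
  assumes "packs E i m" "finite T" "\<And>e. e \<in> E \<Longrightarrow> e \<inter> T \<noteq> {}"
  shows "i \<le> sum m T"
  using assms(1)
proof (induction i arbitrary: m)
  case (Suc i)
  then obtain e where e: "e \<in> E" "\<forall>v\<in>e. 0 < m v"
    "packs E i (\<lambda>v. if v \<in> e then m v - 1 else m v)"
    by auto
  obtain x where x: "x \<in> e" "x \<in> T"
    using assms(3) e(1) by blast
  have "i \<le> (\<Sum>v\<in>T. if v \<in> e then m v - 1 else m v)"
    using Suc.IH e(3) .
  also have "\<dots> < sum m T"
    by (rule sum_strict_mono_ex1[OF assms(2)]) (use x e(2) in \<open>auto intro!: bexI[of _ x]\<close>)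
  finally show ?case
    by simp
qed simp

lemma vertex_cover_finite: "clutter C \<Longrightarrow> vertex_cover C T \<Longrightarrow> finite T"
  unfolding clutter_def vertex_cover_def by (meson finite_subset)

section \<open>Deletion, duplication and parallelization\<close>

lemma packing_property_delete:
  assumes "clutter C" "packing_property C" "x \<in> verts C"
  shows "packing_property (delete x C)"
  unfolding packing_property_def
proof (intro allI impI)
  fix i :: nat and m :: "_ \<Rightarrow> nat" assume cov: "\<forall>T. vertex_cover (delete x C) T \<longrightarrow> i \<le> sum m T"
  \<comment> \<open>A packing below a weight that vanishes at \<open>x\<close> can only use edges
    avoiding \<open>x\<close>, and these are the edges that survive.\<close>
  have restrict: "packs (edges (delete x C)) k n" if "packs (edges C) k n" "n x = 0" for k n
    using that
  proof (induction k arbitrary: n)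
    case (Suc k)
    then obtain e where e: "e \<in> edges C" "\<forall>v\<in>e. 0 < n v"
      "packs (edges C) k (\<lambda>v. if v \<in> e then n v - 1 else n v)"
      by auto
    have "e \<in> edges (delete x C)"
      using e Suc.prems(2) by (auto simp: delete_def)
    then show ?case
      using e Suc by auto
  qed simp
  have "i \<le> sum (m(x := 0)) T" if T: "vertex_cover C T" for T
  proof -
    have "finite T"
      using vertex_cover_finite[OF assms(1) T] .
    \<comment> \<open>The surviving edges avoid \<open>x\<close>, so they meet \<open>T\<close>
      elsewhere.\<close>
    have "vertex_cover (delete x C) (T - {x})"
      using T by (auto simp: vertex_cover_def delete_def)
    then have "i \<le> sum m (T - {x})"
      using cov by blast
    also have "\<dots> = sum (m(x := 0)) (T - {x})"
      by (rule sum.cong) auto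
    also have "\<dots> \<le> sum (m(x := 0)) T"
      using \<open>finite T\<close> by (intro sum_mono2) auto
    finally show ?thesis .
  qed
  then have "packs (edges C) i (m(x := 0))"
    using assms(2) by (auto simp: packing_property_def)
  then have "packs (edges (delete x C)) i (m(x := 0))"
    by (rule restrict) simp
  then show "packs (edges (delete x C)) i m"
    by (rule packs_mono) simp
qed

lemma packing_property_duplicate:
  assumes "clutter C" "packing_property C" "x \<in> verts C" "x' \<notin> verts C"
  shows "packing_property (duplicate x x' C)"
  unfolding packing_property_def
proof (intro allI impI)
  let ?D = "duplicate x x' C"
  fix i :: nat and m :: "_ \<Rightarrow> nat" assume cov: "\<forall>T. vertex_cover ?D T \<longrightarrow> i \<le> sum m T"
  have sub: "\<And>e. e \<in> edges C \<Longrightarrow> e \<subseteq> verts C"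
    using assms(1) by (auto simp: clutter_def)
  have x': "x \<noteq> x'" "\<And>e. e \<in> edges C \<Longrightarrow> x' \<notin> e"
    using assms(3,4) sub by auto
  have split: "packs (edges ?D) k n" if "packs (edges C) k (n(x := n x + n x', x' := 0))" for k n
    using that
  proof (induction k arbitrary: n)
    case (Suc k)
    let ?n = "n(x := n x + n x', x' := 0)"
    from Suc.prems obtain e where e: "e \<in> edges C" "\<forall>v\<in>e. 0 < ?n v"
      "packs (edges C) k (\<lambda>v. if v \<in> e then ?n v - 1 else ?n v)"
      unfolding packs.simps by blast
    \<comment> \<open>The edge passes to the new copy exactly when the weight of \<open>x\<close> is
      exhausted. Positivity of the merged weight at \<open>x\<close> then forces
      \<open>0 < n x'\<close>.\<close>
    define f where "f = (if x \<in> e \<and> n x = 0 then insert x' (e - {x}) else e)"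
    have f: "f \<in> edges ?D"
      using e(1) by (auto simp: f_def duplicate_def)
    have pos: "\<forall>v\<in>f. 0 < n v"
      using e(1,2) x' by (auto simp: f_def split: if_splits)
    let ?k = "\<lambda>v. if v \<in> f then n v - 1 else n v"
    \<comment> \<open>Whichever copy is used, the total weight of the two copies drops by one, so
      merging the new weight gives what remains of the merged weight after removing
      \<open>e\<close>.\<close>
    have "packs (edges C) k (?k(x := ?k x + ?k x', x' := 0))"
    proof (rule packs_mono[OF e(3)])
      fix v
      show "(if v \<in> e then ?n v - 1 else ?n v) \<le> (?k(x := ?k x + ?k x', x' := 0)) v"
      proof (cases "v = x")
        case True
        then show ?thesis
          using x'(1) x'(2)[OF e(1)] by (cases "x \<in> e"; cases "n x = 0") (simp_all add: f_def)
      next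
        case False
        then show ?thesis
          using x'(2)[OF e(1)] by (cases "v = x'") (simp_all add: f_def)
      qed
    qed
    then have "packs (edges ?D) k ?k"
      by (rule Suc.IH)
    then show ?case
      using f pos by auto
  qed simp
  have "i \<le> sum (m(x := m x + m x', x' := 0)) T" if T: "vertex_cover C T" for T
  proof -
    have "finite T" and x'T: "x' \<notin> T"
      using T vertex_cover_finite[OF assms(1)] assms(4) by (auto simp: vertex_cover_def)
    show ?thesis
    proof (cases "x \<in> T")
      case True
      \<comment> \<open>If \<open>x\<close> is in the cover, its copy is added too; the weight of
        both is the merged weight of \<open>x\<close>.\<close>
      have "vertex_cover ?D (insert x' T)"
        using T by (auto simp: vertex_cover_def duplicate_def)
      then have "i \<le> sum m (insert x' T)"
        using cov by blast
      also have "\<dots> = m x' + (m x + sum m (T - {x}))"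
        using \<open>finite T\<close> x'T True by (simp add: sum.remove)
      also have "sum m (T - {x}) = sum (m(x := m x + m x', x' := 0)) (T - {x})"
        using x'T by (intro sum.cong) auto
      also have "m x' + (m x + \<dots>) = sum (m(x := m x + m x', x' := 0)) T"
        using sum.remove[OF \<open>finite T\<close> True, of "m(x := m x + m x', x' := 0)"] x'(1) by simp
      finally show ?thesis .
    next
      case False
      \<comment> \<open>A cover avoiding \<open>x\<close> meets each edge in another vertex, which
        the modified edge retains.\<close>
      have "insert x' (e - {x}) \<inter> T \<noteq> {}" if "e \<in> edges C" for e
        using T False that by (auto simp: vertex_cover_def)
      then have "vertex_cover ?D T"
        using T unfolding vertex_cover_def duplicate_def by auto
      then have "i \<le> sum m T"
        using cov by blast
      also have "\<dots> = sum (m(x := m x + m x', x' := 0)) T"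
        using False x'T by (intro sum.cong) auto
      finally show ?thesis .
    qed
  qed
  then show "packs (edges ?D) i m"
    using assms(2) by (intro split) (auto simp: packing_property_def)
qed

lemma packing_property_parallelization:
  assumes "parallelization C D" "clutter C" "packing_property C"
  shows "packing_property D"
  using assms(1)
proof induction
  case refl
  show ?case by (rule assms(3))
next
  case (duplicate D x x')
  show ?case
    using packing_property_duplicate[OF clutter_parallelization[OF duplicate.hyps(1) assms(2)]
        duplicate.IH duplicate.hyps(2,3)] .
next
  case (delete D x)
  show ?case
    using packing_property_delete[OF clutter_parallelization[OF delete.hyps(1) assms(2)]
        delete.IH delete.hyps(2)] .
qed

section \<open>Minimal vertex covers\<close>

lemma minimal_cover_subset:
  assumes "clutter C" "vertex_cover C T"
  obtains S where "minimal_cover C S" "S \<subseteq> T"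
proof -
  obtain S where S: "vertex_cover C S \<and> S \<subseteq> T"
    and least: "\<And>U. vertex_cover C U \<and> U \<subseteq> T \<Longrightarrow> card S \<le> card U"
    using ex_has_least_nat[of "\<lambda>S. vertex_cover C S \<and> S \<subseteq> T" T card] assms(2) by auto
  have "finite S"
    using S vertex_cover_finite[OF assms(1)] by blast
  then have "minimal_cover C S"
    using S least unfolding minimal_cover_def by (meson card_seteq order_trans)
  then show ?thesis
    using S that by blast
qed

text \<open>Dropping \<open>x\<close> from a minimal cover leaves some edge uncovered, and that edge
  can meet \<open>T\<close> only in \<open>x\<close>.\<close>

lemma minimal_cover_edge:
  assumes "minimal_cover C T" "x \<in> T"
  obtains e where "e \<in> edges C" "e \<inter> T = {x}"
proof -
  have "\<not> vertex_cover C (T - {x})"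
    using assms by (auto simp: minimal_cover_def)
  then obtain e where e: "e \<in> edges C" "e \<inter> (T - {x}) = {}"
    using assms by (auto simp: minimal_cover_def vertex_cover_def)
  moreover have "e \<inter> T \<noteq> {}"
    using assms(1) e(1) by (simp add: minimal_cover_def vertex_cover_def)
  ultimately have "e \<inter> T = {x}"
    by blast
  then show ?thesis
    using e(1) that by blast
qed


section \<open>Leading monomials\<close>

text \<open>Refining the weight by the exponents gives a lexicographic order on monomials; the product
  of the least monomials of the two factors cannot cancel. No order on the variables themselves
  is available, whence the auxiliary numbering.\<close>

lemma keys_mult_least_weight:
  fixes p q :: "('v, 'k::field) mpoly" and w :: "('v \<Rightarrow>\<^sub>0 nat) \<Rightarrow> nat"
  assumes "p \<noteq> 0" "q \<noteq> 0" and w: "\<And>a b. w (a + b) = w a + w b"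
  obtains a b where "a \<in> Poly_Mapping.keys p" "b \<in> Poly_Mapping.keys q"
    "a + b \<in> Poly_Mapping.keys (p * q)"
    "\<And>c. c \<in> Poly_Mapping.keys p \<Longrightarrow> w a \<le> w c"
    "\<And>c. c \<in> Poly_Mapping.keys q \<Longrightarrow> w b \<le> w c"
proof -
  let ?A = "Poly_Mapping.keys p" and ?B = "Poly_Mapping.keys q"
  define V where "V = (\<Union>a\<in>?A \<union> ?B. Poly_Mapping.keys a)"
  have "finite V"
    by (simp add: V_def)
  then obtain g :: "'v \<Rightarrow> nat" where g: "inj_on g V"
    using finite_imp_inj_to_nat_seg by blast
  \<comment> \<open>Coordinate 0 holds the weight and is compared first; coordinate
    \<open>Suc (g v)\<close> holds the exponent of \<open>v\<close>. Thus \<open>f\<close> is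
    additive, injective on monomials in \<open>V\<close>, and its values are linearly
    ordered.\<close>
  define f :: "('v \<Rightarrow>\<^sub>0 nat) \<Rightarrow> (nat \<Rightarrow>\<^sub>0 nat)" where
    "f a = Poly_Mapping.single 0 (w a) +
       (\<Sum>v\<in>V. Poly_Mapping.single (Suc (g v)) (Poly_Mapping.lookup a v))" for a
  have f_add: "f (a + b) = f a + f b" for a b
    by (simp add: f_def w lookup_add single_add sum.distrib ac_simps)
  have f0: "Poly_Mapping.lookup (f a) 0 = w a" for a
    by (simp add: f_def lookup_add lookup_sum lookup_single)
  have fS: "Poly_Mapping.lookup (f a) (Suc (g v)) = Poly_Mapping.lookup a v" if "v \<in> V" for a v
  proof -
    have "Poly_Mapping.lookup (f a) (Suc (g v)) = (\<Sum>u\<in>V. if u = v then Poly_Mapping.lookup a u else 0)"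
      unfolding f_def lookup_add lookup_sum lookup_single
      using g that by (auto simp: when_def inj_on_eq_iff intro!: sum.cong)
    then show ?thesis
      using \<open>finite V\<close> that by simp
  qed
  have f_inj: "a = b" if "f a = f b" "Poly_Mapping.keys a \<subseteq> V" "Poly_Mapping.keys b \<subseteq> V" for a b
  proof (rule poly_mapping_eqI)
    fix v show "Poly_Mapping.lookup a v = Poly_Mapping.lookup b v"
      using that fS[of v a] fS[of v b] by (metis in_keys_iff subsetD)
  qed
  have f_le: "w a \<le> w b" if "f a \<le> f b" for a b
  proof -
    have "f a = f b \<or> less_fun (Poly_Mapping.lookup (f a)) (Poly_Mapping.lookup (f b))"
      using that by (auto simp: less_eq_poly_mapping.rep_eq lookup_inject)
    then have "Poly_Mapping.lookup (f a) 0 \<le> Poly_Mapping.lookup (f b) 0"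
      unfolding less_fun_def by (metis gr0I less_imp_le order_refl)
    then show ?thesis
      by (simp add: f0)
  qed
  have "finite (f ` ?A)" "f ` ?A \<noteq> {}" "finite (f ` ?B)" "f ` ?B \<noteq> {}"
    using assms(1,2) by auto
  then have "Min (f ` ?A) \<in> f ` ?A" "Min (f ` ?B) \<in> f ` ?B"
    by (meson Min_in)+
  then obtain a b where a: "a \<in> ?A" "f a = Min (f ` ?A)" and b: "b \<in> ?B" "f b = Min (f ` ?B)"
    by (metis imageE)
  have a_le: "f a \<le> f c" if "c \<in> ?A" for c
    using that by (simp add: a(2))
  have b_le: "f b \<le> f c" if "c \<in> ?B" for c
    using that by (simp add: b(2))
  \<comment> \<open>Both \<open>f a\<close> and \<open>f b\<close> are minimal, so equal sums force
    equality in each summand.\<close>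
  have unique: "c = a \<and> d = b" if "c \<in> ?A" "d \<in> ?B" "a + b = c + d" for c d
  proof -
    have "f a + f b = f c + f d"
      using that(3) by (metis f_add)
    moreover have "f a \<le> f c" "f b \<le> f d"
      using a_le b_le that by auto
    ultimately have "f a = f c"
      by (metis add_le_less_mono add_less_le_mono less_irrefl order_le_less)
    moreover have "Poly_Mapping.keys c \<subseteq> V" "Poly_Mapping.keys a \<subseteq> V"
      using that(1) a(1) by (auto simp: V_def)
    ultimately have "c = a"
      using f_inj by metis
    then show ?thesis
      using that(3) by simp
  qed
  \<comment> \<open>By uniqueness the convolution sum at \<open>a + b\<close> reduces to one product
    of nonzero coefficients, which is nonzero in a field.\<close>
  have "Poly_Mapping.lookup (p * q) (a + b) =
      (\<Sum>l. Poly_Mapping.lookup p l * (\<Sum>k. Poly_Mapping.lookup q k when a + b = l + k))"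
    by (rule lookup_mult)
  also have "\<dots> = (\<Sum>l. Poly_Mapping.lookup p l * Poly_Mapping.lookup q b when l = a)"
  proof (rule Sum_any.cong)
    fix l
    show "Poly_Mapping.lookup p l * (\<Sum>k. Poly_Mapping.lookup q k when a + b = l + k) =
        (Poly_Mapping.lookup p l * Poly_Mapping.lookup q b when l = a)"
    proof (cases "l \<in> ?A")
      case True
      have "(Poly_Mapping.lookup q k when a + b = l + k) = (Poly_Mapping.lookup q k when l = a when k = b)" for k
      proof (cases "k \<in> ?B")
        case k: True
        then show ?thesis
          using unique[OF True k] by (auto simp: when_def)
      qed (simp add: in_keys_iff)
      then show ?thesis
        by (simp add: mult_when)
    qed (simp add: in_keys_iff)
  qed
  also have "\<dots> = Poly_Mapping.lookup p a * Poly_Mapping.lookup q b"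
    by simp
  finally have "a + b \<in> Poly_Mapping.keys (p * q)"
    using a(1) b(1) by (simp add: in_keys_iff)
  then show ?thesis
    using that a(1) b(1) f_le a_le b_le by blast
qed


section \<open>Monomial ideals\<close>

text \<open>The predicate takes plain exponent functions, so that \<open>packs E i\<close> can be
  inserted directly. For monotone \<open>P\<close> this is a monomial ideal.\<close>

definition monomial_set :: "'v set \<Rightarrow> (('v \<Rightarrow> nat) \<Rightarrow> bool) \<Rightarrow> ('v, 'k::field) mpoly set" where
  "monomial_set V P =
     {p \<in> carrier (polynomial_ring V). \<forall>a\<in>Poly_Mapping.keys p. P (Poly_Mapping.lookup a)}"

definition exponents :: "'v set \<Rightarrow> ('v \<Rightarrow> nat) \<Rightarrow> 'v \<Rightarrow>\<^sub>0 nat" where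
  "exponents V m = (\<Sum>v\<in>V. Poly_Mapping.single v (m v))"

text \<open>For \<open>T \<subseteq> V\<close> this is the ideal generated by the variables in
  \<open>T\<close>: each monomial is divisible by one of them.\<close>

abbreviation cover_ideal :: "'v set \<Rightarrow> 'v set \<Rightarrow> ('v, 'k::field) mpoly set" where
  "cover_ideal V T \<equiv> monomial_set V (\<lambda>m. \<exists>v\<in>T. 0 < m v)"

lemma polynomial_ring_simps [simp]:
  "mult (polynomial_ring V) = (*)" "one (polynomial_ring V) = 1"
  "zero (polynomial_ring V) = 0" "add (polynomial_ring V) = (+)"
  by (simp_all add: polynomial_ring_def)

lemma carrier_polynomial_ring:
  "p \<in> carrier (polynomial_ring V) \<longleftrightarrow> (\<forall>a\<in>Poly_Mapping.keys p. Poly_Mapping.keys a \<subseteq> V)"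
  by (simp add: polynomial_ring_def)

lemma lookup_exponents:
  "finite V \<Longrightarrow> Poly_Mapping.lookup (exponents V m) v = (if v \<in> V then m v else 0)"
  by (simp add: exponents_def lookup_sum lookup_single when_def)

lemma keys_exponents: "finite V \<Longrightarrow> Poly_Mapping.keys (exponents V m) \<subseteq> V"
  by (auto simp: in_keys_iff lookup_exponents split: if_splits)

lemma exponents_add:
  "exponents V m + exponents V n = exponents V (\<lambda>v. m v + n v)"
  by (simp add: exponents_def single_add sum.distrib)

lemma single_in_carrier:
  "Poly_Mapping.keys a \<subseteq> V \<Longrightarrow> Poly_Mapping.single a c \<in> carrier (polynomial_ring V)"
  by (simp add: carrier_polynomial_ring)

lemma poly_mapping_sum_single:
  "p = (\<Sum>a\<in>Poly_Mapping.keys p. Poly_Mapping.single a (Poly_Mapping.lookup p a))"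
  by (rule poly_mapping_eqI) (simp add: lookup_sum lookup_single when_def in_keys_iff)

lemma prod_var_eq_exponents:
  "finite e \<Longrightarrow> (\<Prod>x\<in>e. var x) = Poly_Mapping.single (exponents e (\<lambda>_. 1)) 1"
  by (induction e rule: finite_induct) (simp_all add: exponents_def var_def mult_single)

text \<open>Every monomial of \<open>q * p\<close> is a multiple of a monomial of \<open>p\<close>,
  and a monotone predicate passes to multiples.\<close>

lemma monomial_set_ideal:
  assumes "mono P"
  shows "ideal (monomial_set V P :: ('v, 'k::field) mpoly set) (polynomial_ring V)"
proof -
  interpret R: cring "polynomial_ring V :: ('v, 'k) mpoly ring"
    by (rule cring_polynomial_ring)
  have le: "P n" if "P m" "\<And>v. m v \<le> n v" for m n
    using assms that by (metis le_boolD le_funI monoD)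
  have neg: "- p \<in> monomial_set V P" if "p \<in> monomial_set V P" for p :: "('v, 'k) mpoly"
    using that by (simp add: monomial_set_def carrier_polynomial_ring in_keys_iff)
  have inv: "inv\<^bsub>add_monoid (polynomial_ring V)\<^esub> p = - p"
    if "p \<in> monomial_set V P" for p :: "('v, 'k) mpoly"
    using R.minus_equality[of "- p" p] that neg[OF that]
    unfolding a_inv_def by (simp add: monomial_set_def)
  have mult: "q * p \<in> monomial_set V P"
    if p: "p \<in> monomial_set V P" and q: "q \<in> carrier (polynomial_ring V)"
    for p q :: "('v, 'k) mpoly"
  proof -
    have "P (Poly_Mapping.lookup a)" if a: "a \<in> Poly_Mapping.keys (q * p)" for a
    proof -
      obtain b c where "a = b + c" "c \<in> Poly_Mapping.keys p"
        using keys_mult[of q p] a by blast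
      then show ?thesis
        using p by (auto simp: monomial_set_def lookup_add intro: le)
    qed
    then show ?thesis
      using p q R.m_closed[of q p] by (simp add: monomial_set_def)
  qed
  have add: "p + q \<in> monomial_set V P"
    if "p \<in> monomial_set V P" "q \<in> monomial_set V P" for p q :: "('v, 'k) mpoly"
    using that R.a_closed[of p q] keys_add[of p q] by (auto simp: monomial_set_def)
  show ?thesis
  proof (rule idealI[OF R.ring_axioms])
    show "subgroup (monomial_set V P :: ('v, 'k) mpoly set) (add_monoid (polynomial_ring V))"
    proof (rule subgroup.intro)
      fix p :: "('v, 'k) mpoly" assume "p \<in> monomial_set V P"
      then show "inv\<^bsub>add_monoid (polynomial_ring V)\<^esub> p \<in> monomial_set V P"
        using inv neg by metis
    qed (simp_all add: add, auto simp: monomial_set_def carrier_polynomial_ring)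
    fix p q :: "('v, 'k) mpoly"
    assume "p \<in> monomial_set V P" "q \<in> carrier (polynomial_ring V)"
    then have "q * p \<in> monomial_set V P"
      by (rule mult)
    then show "q \<otimes>\<^bsub>polynomial_ring V\<^esub> p \<in> monomial_set V P"
      and "p \<otimes>\<^bsub>polynomial_ring V\<^esub> q \<in> monomial_set V P"
      by (simp_all add: mult.commute)
  qed
qed

text \<open>A polynomial is the finite sum of its terms, so inclusions of monomial ideals may be
  checked on single terms.\<close>

lemma monomial_set_subset_ideal:
  assumes J: "ideal J (polynomial_ring V :: ('v, 'k::field) mpoly ring)"
    and mono: "\<And>a c. Poly_Mapping.keys a \<subseteq> V \<Longrightarrow> P (Poly_Mapping.lookup a) \<Longrightarrow>
      Poly_Mapping.single a c \<in> J"
  shows "monomial_set V P \<subseteq> J"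
proof
  fix p :: "('v, 'k) mpoly" assume p: "p \<in> monomial_set V P"
  interpret ideal J "polynomial_ring V :: ('v, 'k) mpoly ring"
    by (rule J)
  have "(\<Sum>a\<in>A. Poly_Mapping.single a (Poly_Mapping.lookup p a)) \<in> J"
    if "finite A" "A \<subseteq> Poly_Mapping.keys p" for A
    using that
  proof (induction A rule: finite_induct)
    case empty
    then show ?case using additive_subgroup.zero_closed[OF is_additive_subgroup] by simp
  next
    case (insert a A)
    have "Poly_Mapping.single a (Poly_Mapping.lookup p a) \<in> J"
      using insert.prems p by (intro mono) (auto simp: monomial_set_def carrier_polynomial_ring)
    then show ?case
      using insert additive_subgroup.a_closed[OF is_additive_subgroup] by simp
  qed
  then show "p \<in> J"
    using poly_mapping_sum_single[of p] by (metis finite_keys order_refl)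
qed

lemma ideal_single_add:
  assumes "ideal J (polynomial_ring V :: ('v, 'k::field) mpoly ring)"
    and "Poly_Mapping.single a c \<in> J" "Poly_Mapping.keys b \<subseteq> V"
  shows "Poly_Mapping.single (a + b) (c * d) \<in> J"
  using ideal.I_r_closed[OF assms(1,2) single_in_carrier[OF assms(3), of d]]
  by (simp add: mult_single)

text \<open>The exponents of the quotient \<open>b\<close> have exactly the form found in the
  recursion of \<open>packs\<close>.\<close>

lemma divide_exponents:
  assumes "finite e" "\<And>v. v \<in> e \<Longrightarrow> 0 < Poly_Mapping.lookup a v"
  obtains b where "a = exponents e (\<lambda>_. 1) + b" "Poly_Mapping.keys b \<subseteq> Poly_Mapping.keys a"
    "Poly_Mapping.lookup b =
      (\<lambda>v. if v \<in> e then Poly_Mapping.lookup a v - 1 else Poly_Mapping.lookup a v)"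
proof -
  let ?b = "a - exponents e (\<lambda>_. 1)"
  have b: "Poly_Mapping.lookup ?b v =
      (if v \<in> e then Poly_Mapping.lookup a v - 1 else Poly_Mapping.lookup a v)" for v
    using assms(1) by (simp add: lookup_minus lookup_exponents)
  have "a = exponents e (\<lambda>_. 1) + ?b"
    using assms
    by (intro poly_mapping_eqI) (fastforce simp: lookup_add lookup_minus lookup_exponents)
  moreover have "Poly_Mapping.keys ?b \<subseteq> Poly_Mapping.keys a"
    using b by (auto simp: in_keys_iff split: if_splits)
  ultimately show ?thesis
    using that[of ?b] b by (simp add: fun_eq_iff)
qed

section \<open>Edge ideals and their powers\<close>

lemma clutter_edge_finite: "clutter C \<Longrightarrow> e \<in> edges C \<Longrightarrow> finite e"
  unfolding clutter_def by (meson PowD finite_subset subsetD)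

lemma prod_var_in_carrier:
  assumes "clutter C" "e \<in> edges C"
  shows "(\<Prod>x\<in>e. var x :: ('v, 'k::field) mpoly) \<in> carrier (polynomial_ring (verts C))"
proof -
  have "e \<subseteq> verts C"
    using assms by (auto simp: clutter_def)
  then show ?thesis
    using keys_exponents[OF clutter_edge_finite[OF assms], of "\<lambda>_. 1"]
    by (simp add: prod_var_eq_exponents[OF clutter_edge_finite[OF assms]] single_in_carrier)
qed

lemma edge_ideal_is_ideal:
  assumes "clutter C"
  shows "ideal (edge_ideal C :: ('v, 'k::field) mpoly set) (polynomial_ring (verts C))"
proof -
  interpret R: cring "polynomial_ring (verts C) :: ('v, 'k) mpoly ring"
    by (rule cring_polynomial_ring)
  show ?thesis
    unfolding edge_ideal_def
    by (rule R.genideal_ideal) (use prod_var_in_carrier[OF assms] in blast)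
qed

lemma prod_var_in_edge_ideal:
  assumes "clutter C" "e \<in> edges C"
  shows "(\<Prod>x\<in>e. var x :: ('v, 'k::field) mpoly) \<in> edge_ideal C"
proof -
  interpret R: cring "polynomial_ring (verts C) :: ('v, 'k) mpoly ring"
    by (rule cring_polynomial_ring)
  have "(\<lambda>e. \<Prod>x\<in>e. var x :: ('v, 'k) mpoly) ` edges C \<subseteq> edge_ideal C"
    unfolding edge_ideal_def
    by (rule R.genideal_self) (use prod_var_in_carrier[OF assms(1)] in blast)
  then show ?thesis
    using assms(2) by blast
qed

lemma edge_ideal_subset:
  assumes "ideal J (polynomial_ring (verts C) :: ('v, 'k::field) mpoly ring)"
    and "\<And>e. e \<in> edges C \<Longrightarrow> (\<Prod>x\<in>e. var x) \<in> J"
  shows "edge_ideal C \<subseteq> J"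
proof -
  interpret R: cring "polynomial_ring (verts C) :: ('v, 'k) mpoly ring"
    by (rule cring_polynomial_ring)
  show ?thesis
    unfolding edge_ideal_def by (rule R.genideal_minimal) (use assms in auto)
qed

lemma edge_ideal_subset_packs:
  assumes "clutter C"
  shows "edge_ideal C \<subseteq> (monomial_set (verts C) (packs (edges C) 1) :: ('v, 'k::field) mpoly set)"
proof (rule edge_ideal_subset)
  fix e assume e: "e \<in> edges C"
  have "packs (edges C) 1 (Poly_Mapping.lookup (exponents e (\<lambda>_. 1)))"
    using e clutter_edge_finite[OF assms e] by (auto simp: lookup_exponents)
  then show "(\<Prod>x\<in>e. var x) \<in> (monomial_set (verts C) (packs (edges C) 1) :: ('v, 'k) mpoly set)"
    using prod_var_in_carrier[OF assms e, where 'k='k]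
    by (simp add: monomial_set_def prod_var_eq_exponents[OF clutter_edge_finite[OF assms e]])
qed (rule monomial_set_ideal[OF mono_packs])

text \<open>Induction on \<open>i\<close>. Monomials of a product of two polynomials are sums of
  exponents, so packings combine by \<open>packs_add\<close>; conversely one step of
  \<open>packs\<close> splits an edge off a term. The zeroth power is the whole ring, matching
  \<open>packs E 0\<close>.\<close>

lemma ideal_power_edge_ideal:
  assumes "clutter C"
  shows "ideal_power (polynomial_ring (verts C)) (edge_ideal C) i =
    (monomial_set (verts C) (packs (edges C) i) :: ('v, 'k::field) mpoly set)"
proof (induction i)
  case 0
  then show ?case
    by (auto simp: nat_pow_def ideals_set_def monomial_set_def)
next
  case (Suc i)
  let ?R = "polynomial_ring (verts C) :: ('v, 'k) mpoly ring"
  let ?M = "\<lambda>i. monomial_set (verts C) (packs (edges C) i) :: ('v, 'k) mpoly set"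
  interpret R: cring ?R
    by (rule cring_polynomial_ring)
  have M: "ideal (?M i) ?R" for i
    by (rule monomial_set_ideal[OF mono_packs])
  have I: "ideal (edge_ideal C) ?R"
    by (rule edge_ideal_is_ideal[OF assms])
  have "ideal_power ?R (edge_ideal C) (Suc i) = ideal_prod ?R (?M i) (edge_ideal C)"
    using Suc.IH by (simp add: nat_pow_def ideals_set_def)
  also have "\<dots> = ?M (Suc i)"
  proof
    show "ideal_prod ?R (?M i) (edge_ideal C) \<subseteq> ?M (Suc i)"
    proof
      fix r assume "r \<in> ideal_prod ?R (?M i) (edge_ideal C)"
      then show "r \<in> ?M (Suc i)"
      proof induction
        case (prod p q)
        then have q: "q \<in> ?M 1"
          using edge_ideal_subset_packs[OF assms] by blast
        have "packs (edges C) (Suc i) (Poly_Mapping.lookup a)"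
          if a: "a \<in> Poly_Mapping.keys (p * q)" for a
        proof -
          obtain b c where bc: "a = b + c" "b \<in> Poly_Mapping.keys p" "c \<in> Poly_Mapping.keys q"
            using keys_mult[of p q] a by blast
          have "packs (edges C) (i + 1) (\<lambda>v. Poly_Mapping.lookup b v + Poly_Mapping.lookup c v)"
            using bc prod(1) q by (intro packs_add) (auto simp: monomial_set_def)
          then show ?thesis
            unfolding bc(1) plus_poly_mapping.rep_eq by (simp only: Suc_eq_plus1)
        qed
        then show ?case
          using R.m_closed[of p q] prod(1) q by (simp add: monomial_set_def)
      next
        case (sum p q)
        then show ?case
          using additive_subgroup.a_closed[OF ideal.axioms(1)[OF M]] by blast
      qed
    qed
  next
    show "?M (Suc i) \<subseteq> ideal_prod ?R (?M i) (edge_ideal C)"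
    proof (rule monomial_set_subset_ideal[OF R.ideal_prod_is_ideal[OF M I]])
      fix a c assume a: "Poly_Mapping.keys a \<subseteq> verts C"
        "packs (edges C) (Suc i) (Poly_Mapping.lookup a)"
      then obtain e where e: "e \<in> edges C" "\<forall>v\<in>e. 0 < Poly_Mapping.lookup a v"
        "packs (edges C) i
          (\<lambda>v. if v \<in> e then Poly_Mapping.lookup a v - 1 else Poly_Mapping.lookup a v)"
        by auto
      obtain b where b: "a = exponents e (\<lambda>_. 1) + b"
        "Poly_Mapping.keys b \<subseteq> Poly_Mapping.keys a"
        "Poly_Mapping.lookup b =
          (\<lambda>v. if v \<in> e then Poly_Mapping.lookup a v - 1 else Poly_Mapping.lookup a v)"
        using divide_exponents[OF clutter_edge_finite[OF assms e(1)]] e(2) by metis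
      have "Poly_Mapping.single b c \<in> ?M i"
        using order_trans[OF b(2) a(1)] b(3) e(3)
        by (simp add: monomial_set_def single_in_carrier)
      then have "Poly_Mapping.single b c * (\<Prod>x\<in>e. var x) \<in> ideal_prod ?R (?M i) (edge_ideal C)"
        using ideal_prod.prod[of _ "?M i" _ "edge_ideal C" ?R]
          prod_var_in_edge_ideal[OF assms e(1)] by simp
      then show "Poly_Mapping.single a c \<in> ideal_prod ?R (?M i) (edge_ideal C)"
        unfolding b(1) prod_var_eq_exponents[OF clutter_edge_finite[OF assms e(1)]]
        by (simp add: mult_single add.commute)
    qed
  qed
  finally show ?case .
qed


section \<open>Minimal primes and symbolic powers\<close>

lemma var_in_carrier:
  "v \<in> V \<Longrightarrow> (var v :: ('v, 'k::field) mpoly) \<in> carrier (polynomial_ring V)"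
  by (simp add: var_def single_in_carrier)

lemma var_in_cover_ideal:
  "v \<in> V \<Longrightarrow> (var v :: ('v, 'k::field) mpoly) \<in> cover_ideal V T \<longleftrightarrow> v \<in> T"
  using var_in_carrier[of v V, where 'k='k]
  by (auto simp: monomial_set_def var_def lookup_single when_def)

text \<open>Let \<open>w\<close> be the degree in the variables of \<open>T\<close>; a monomial lies
  outside the ideal iff its weight is 0. If neither factor lies in the ideal, both have monomials of
  weight 0, and a sum of least ones survives in the product.\<close>

lemma cover_ideal_prime:
  assumes "finite T"
  shows "primeideal (cover_ideal V T :: ('v, 'k::field) mpoly set) (polynomial_ring V)"
proof (rule primeidealI)
  let ?P = "cover_ideal V T :: ('v, 'k) mpoly set"
  show "ideal ?P (polynomial_ring V)"
    by (intro monomial_set_ideal monoI le_boolI) (meson le_funD order_less_le_trans)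
  show "cring (polynomial_ring V :: ('v, 'k) mpoly ring)"
    by (rule cring_polynomial_ring)
  show "carrier (polynomial_ring V) \<noteq> ?P"
  proof -
    have "1 \<in> carrier (polynomial_ring V :: ('v, 'k) mpoly ring)" "1 \<notin> ?P"
      by (auto simp: carrier_polynomial_ring monomial_set_def)
    then show ?thesis by blast
  qed
  fix p q :: "('v, 'k) mpoly"
  assume p: "p \<in> carrier (polynomial_ring V)" and q: "q \<in> carrier (polynomial_ring V)"
    and pq: "p \<otimes>\<^bsub>polynomial_ring V\<^esub> q \<in> ?P"
  define w where "w a = sum (Poly_Mapping.lookup a) T" for a :: "'v \<Rightarrow>\<^sub>0 nat"
  have w0: "w a = 0 \<longleftrightarrow> \<not> (\<exists>v\<in>T. 0 < Poly_Mapping.lookup a v)" for a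
    using assms by (auto simp: w_def)
  show "p \<in> ?P \<or> q \<in> ?P"
  proof (rule ccontr)
    assume "\<not> (p \<in> ?P \<or> q \<in> ?P)"
    then obtain c d where c: "c \<in> Poly_Mapping.keys p" "w c = 0"
      and d: "d \<in> Poly_Mapping.keys q" "w d = 0"
      using p q w0 by (auto simp: monomial_set_def)
    have "p \<noteq> 0" "q \<noteq> 0" "\<And>a b. w (a + b) = w a + w b"
      using c d by (auto simp: w_def lookup_add sum.distrib)
    then obtain a b where "w a \<le> w c" "w b \<le> w d" "a + b \<in> Poly_Mapping.keys (p * q)"
      using keys_mult_least_weight[of p q w] c(1) d(1) by metis
    moreover from this have "w (a + b) = 0"
      using c d by (simp add: w_def lookup_add sum.distrib)
    ultimately show False
      using pq w0 by (auto simp: monomial_set_def)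
  qed
qed

lemma edge_ideal_subset_cover_ideal:
  assumes "clutter C" "vertex_cover C T"
  shows "edge_ideal C \<subseteq> (cover_ideal (verts C) T :: ('v, 'k::field) mpoly set)"
proof (rule edge_ideal_subset)
  have "finite T"
    using vertex_cover_finite[OF assms] .
  then show "ideal (cover_ideal (verts C) T :: ('v, 'k) mpoly set) (polynomial_ring (verts C))"
    using cover_ideal_prime primeideal.axioms(1) by blast
  fix e assume e: "e \<in> edges C"
  have "e \<inter> T \<noteq> {}"
    using assms(2) e by (simp add: vertex_cover_def)
  then have "\<exists>v\<in>T. 0 < Poly_Mapping.lookup (exponents e (\<lambda>_. 1)) v"
    using clutter_edge_finite[OF assms(1) e] by (auto simp: lookup_exponents)
  then show "(\<Prod>x\<in>e. var x) \<in> (cover_ideal (verts C) T :: ('v, 'k) mpoly set)"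
    using prod_var_in_carrier[OF assms(1) e, where 'k='k]
    by (simp add: monomial_set_def prod_var_eq_exponents[OF clutter_edge_finite[OF assms(1) e]])
qed

text \<open>A prime containing the product of an edge contains one of its variables, so the
  variables in \<open>P\<close> form a cover.\<close>

lemma prime_contains_cover_ideal:
  assumes "clutter C"
    and P: "primeideal P (polynomial_ring (verts C) :: ('v, 'k::field) mpoly ring)"
    and "edge_ideal C \<subseteq> P"
  defines "T \<equiv> {v \<in> verts C. var v \<in> P}"
  shows "vertex_cover C T" "cover_ideal (verts C) T \<subseteq> P"
proof -
  let ?R = "polynomial_ring (verts C) :: ('v, 'k) mpoly ring"
  interpret primeideal P ?R
    by (rule P)
  have factor: "\<exists>v\<in>e. var v \<in> P"
    if "finite e" "e \<subseteq> verts C" "(\<Prod>x\<in>e. var x) \<in> P" for e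
    using that
  proof (induction e rule: finite_induct)
    \<comment> \<open>The empty product is 1, which a proper ideal cannot contain.\<close>
    case empty
    then show ?case
      using one_imp_carrier I_notcarr by simp
  next
    case (insert x e)
    have "(\<Prod>x\<in>e. var x) \<in> carrier ?R"
      unfolding prod_var_eq_exponents[OF insert.hyps(1)]
      using insert.prems keys_exponents[OF insert.hyps(1)] by (intro single_in_carrier) blast
    then have "var x \<in> P \<or> (\<Prod>x\<in>e. var x) \<in> P"
      using insert I_prime[of "var x" "\<Prod>x\<in>e. var x"] by (simp add: var_in_carrier)
    then show ?case
      using insert by auto
  qed
  have "e \<inter> T \<noteq> {}" if e: "e \<in> edges C" for e
  proof -
    have "e \<subseteq> verts C"
      using assms(1) e by (auto simp: clutter_def)
    then show ?thesis
      using factor[OF clutter_edge_finite[OF assms(1) e]] prod_var_in_edge_ideal[OF assms(1) e]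
        assms(3) unfolding T_def by blast
  qed
  then show "vertex_cover C T"
    by (auto simp: vertex_cover_def T_def)
  show "cover_ideal (verts C) T \<subseteq> P"
  proof (rule monomial_set_subset_ideal[OF is_ideal])
    fix a :: "'v \<Rightarrow>\<^sub>0 nat" and c :: 'k
    assume a: "Poly_Mapping.keys a \<subseteq> verts C" "\<exists>v\<in>T. 0 < Poly_Mapping.lookup a v"
    then obtain v where v: "v \<in> T" "0 < Poly_Mapping.lookup a v"
      by blast
    then obtain b where b: "a = exponents {v} (\<lambda>_. 1) + b"
      "Poly_Mapping.keys b \<subseteq> Poly_Mapping.keys a"
      using divide_exponents[of "{v}" a] by (metis finite.emptyI finite_insert singletonD)
    have "Poly_Mapping.single (exponents {v} (\<lambda>_. 1)) 1 \<in> P"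
      using v(1) by (simp add: T_def var_def exponents_def)
    then have "Poly_Mapping.single (exponents {v} (\<lambda>_. 1) + b) (1 * c) \<in> P"
      using ideal_single_add[OF is_ideal] a(1) b(2) by blast
    then show "Poly_Mapping.single a c \<in> P"
      by (simp add: b(1))
  qed
qed

lemma cover_ideal_inject:
  assumes "cover_ideal V S \<subseteq> (cover_ideal V T :: ('v, 'k::field) mpoly set)" "S \<subseteq> V"
  shows "S \<subseteq> T"
proof
  fix v assume "v \<in> S"
  then show "v \<in> T"
    using assms var_in_cover_ideal[of v V S, where 'k='k] var_in_cover_ideal[of v V T, where 'k='k]
    by (meson subsetD)
qed

text \<open>Cover ideals are primes over the edge ideal, and every prime over it contains one of
  them. Their inclusions correspond to inclusions of covers, so minimality agrees on both
  sides.\<close>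

lemma minimal_prime_edge_ideal_iff:
  fixes P :: "('v, 'k::field) mpoly set"
  assumes "clutter C"
  shows "minimal_prime (polynomial_ring (verts C)) (edge_ideal C) P \<longleftrightarrow>
    (\<exists>T. minimal_cover C T \<and> P = cover_ideal (verts C) T)"
proof
  have fin: "finite T" if "vertex_cover C T" for T
    using vertex_cover_finite[OF assms that] .
  let ?R = "polynomial_ring (verts C) :: ('v, 'k) mpoly ring"
  {
    assume P: "minimal_prime ?R (edge_ideal C) P"
    then have prime: "primeideal P ?R" "edge_ideal C \<subseteq> P"
      by (auto simp: minimal_prime_def)
    define T where "T = {v \<in> verts C. var v \<in> P}"
    have T: "vertex_cover C T" "cover_ideal (verts C) T \<subseteq> P"
      using prime_contains_cover_ideal[OF assms prime] by (simp_all add: T_def)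
    \<comment> \<open>Used twice: with \<open>S = T\<close> it identifies \<open>P\<close>, and for
      smaller \<open>S\<close> it shows that \<open>T\<close> is minimal.\<close>
    have eq: "cover_ideal (verts C) S = P" if S: "vertex_cover C S" "S \<subseteq> T" for S
    proof -
      have "cover_ideal (verts C) S \<subseteq> (cover_ideal (verts C) T :: ('v, 'k) mpoly set)"
        using S(2) unfolding monomial_set_def by blast
      then show ?thesis
        using P T(2) cover_ideal_prime[OF fin[OF S(1)], of "verts C", where 'k='k]
          edge_ideal_subset_cover_ideal[OF assms S(1), where 'k='k]
        unfolding minimal_prime_def by (meson order_trans)
    qed
    have "minimal_cover C T"
      unfolding minimal_cover_def
    proof (intro conjI allI impI T(1))
      fix S assume S: "vertex_cover C S \<and> S \<subseteq> T"
      then have "cover_ideal (verts C) T \<subseteq> (cover_ideal (verts C) S :: ('v, 'k) mpoly set)"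
        using eq T by blast
      moreover have "T \<subseteq> verts C"
        using T(1) by (simp add: vertex_cover_def)
      ultimately have "T \<subseteq> S"
        by (rule cover_ideal_inject)
      then show "S = T"
        using S by blast
    qed
    then show "\<exists>T. minimal_cover C T \<and> P = cover_ideal (verts C) T"
      using eq T(1) by blast
  next
    assume "\<exists>T. minimal_cover C T \<and> P = cover_ideal (verts C) T"
    then obtain T where T: "minimal_cover C T" and P: "P = cover_ideal (verts C) T"
      by blast
    then have cover: "vertex_cover C T"
      by (simp add: minimal_cover_def)
    show "minimal_prime ?R (edge_ideal C) P"
      unfolding minimal_prime_def
    proof (intro conjI allI impI)
      show "primeideal P ?R"
        unfolding P by (rule cover_ideal_prime[OF fin[OF cover]])
      show "edge_ideal C \<subseteq> P"
        unfolding P by (rule edge_ideal_subset_cover_ideal[OF assms cover])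
      fix Q assume Q: "primeideal Q ?R \<and> edge_ideal C \<subseteq> Q \<and> Q \<subseteq> P"
      define S where "S = {v \<in> verts C. var v \<in> Q}"
      have S: "vertex_cover C S" "cover_ideal (verts C) S \<subseteq> Q"
        using prime_contains_cover_ideal[OF assms, of Q] Q by (simp_all add: S_def)
      have "S \<subseteq> T"
        using Q P var_in_cover_ideal[of _ "verts C" T, where 'k='k] by (auto simp: S_def)
      then have "S = T"
        using T S(1) by (simp add: minimal_cover_def)
      then show "Q = P"
        using S(2) P Q by blast
    qed
  }
qed

text \<open>The witness outside the minimal prime of \<open>T\<close> completes every variable \<open>x\<close> of \<open>T\<close> to an edge
  meeting \<open>T\<close> in \<open>x\<close> only.\<close>

lemma packing_property_if_normally_torsion_free:
  assumes C: "clutter C"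
    and ntf: "normally_torsion_free (polynomial_ring (verts C) :: ('v, 'k::field) mpoly ring)
      (edge_ideal C)"
  shows "packing_property C"
  unfolding packing_property_def
proof (intro allI impI)
  let ?R = "polynomial_ring (verts C) :: ('v, 'k) mpoly ring"
  fix i :: nat and m :: "'v \<Rightarrow> nat"
  assume cov: "\<forall>T. vertex_cover C T \<longrightarrow> i \<le> sum m T"
  have fin: "finite (verts C)"
    using C by (simp add: clutter_def)
  define p :: "('v, 'k) mpoly" where "p = Poly_Mapping.single (exponents (verts C) m) 1"
  have "p \<in> symbolic_power ?R (edge_ideal C) i"
    unfolding symbolic_power_def
  proof (intro CollectI conjI allI impI)
    show "p \<in> carrier ?R"
      unfolding p_def by (intro single_in_carrier keys_exponents fin)
    fix P assume "minimal_prime ?R (edge_ideal C) P"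
    then obtain T where T: "minimal_cover C T" and P: "P = cover_ideal (verts C) T"
      using minimal_prime_edge_ideal_iff[OF C] by blast
    have TV: "T \<subseteq> verts C" "finite T"
      using T vertex_cover_finite[OF C] by (auto simp: minimal_cover_def vertex_cover_def)
    have "\<exists>e\<in>edges C. e \<inter> T = {x}" if "x \<in> T" for x
      using minimal_cover_edge[OF T that] by blast
    then obtain e where e: "\<And>x. x \<in> T \<Longrightarrow> e x \<in> edges C \<and> e x \<inter> T = {x}"
      by metis
    \<comment> \<open>The exponents of the product of all \<open>e x\<close>, each taken
      \<open>m x\<close> times, with the factor \<open>x\<close> itself left out of each
      \<open>e x\<close>; the latter is supplied by \<open>p\<close>.\<close>
    define n where "n v = (\<Sum>x\<in>T. if v \<in> e x \<and> v \<noteq> x then m x else 0)" for v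
    define s :: "('v, 'k) mpoly" where "s = Poly_Mapping.single (exponents (verts C) n) 1"
    \<comment> \<open>Within \<open>T\<close> the edge \<open>e x\<close> contains only
      \<open>x\<close>, which \<open>n\<close> omits. Hence no variable of \<open>T\<close> divides
      \<open>s\<close>.\<close>
    have "n v = 0" if "v \<in> T" for v
      unfolding n_def by (rule sum.neutral) (use that e in \<open>auto; blast\<close>)
    then have "s \<notin> P"
      using TV(1) fin by (auto simp: P s_def monomial_set_def lookup_exponents)
    moreover have "s \<in> carrier ?R"
      unfolding s_def by (intro single_in_carrier keys_exponents fin)
    moreover have "s * p \<in> ideal_power ?R (edge_ideal C) i"
    proof -
      have sp: "s * p = Poly_Mapping.single (exponents (verts C) (\<lambda>v. n v + m v)) 1"
        by (simp add: s_def p_def mult_single exponents_add)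
      have "i \<le> sum m T"
        using cov T by (simp add: minimal_cover_def)
      \<comment> \<open>The family packs \<open>sum m T\<close> edges, and the surplus over
        \<open>i\<close> is discarded.\<close>
      then have "packs (edges C) i (\<lambda>v. \<Sum>x\<in>T. if v \<in> e x then m x else 0)"
        using packs_family[OF TV(2), of e "edges C" m] e packs_le by blast
      then have "packs (edges C) i
          (Poly_Mapping.lookup (exponents (verts C) (\<lambda>v. n v + m v)))"
      proof (rule packs_mono)
        fix v
        show "(\<Sum>x\<in>T. if v \<in> e x then m x else 0)
            \<le> Poly_Mapping.lookup (exponents (verts C) (\<lambda>v. n v + m v)) v"
        proof (cases "v \<in> verts C")
          case True
          have "(\<Sum>x\<in>T. if v \<in> e x then m x else 0) \<le>
              (\<Sum>x\<in>T. (if v \<in> e x \<and> v \<noteq> x then m x else 0) + (if x = v then m x else 0))"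
            by (rule sum_mono) auto
          also have "\<dots> \<le> n v + m v"
            using TV(2) by (simp add: sum.distrib n_def)
          finally show ?thesis
            using True fin by (simp add: lookup_exponents)
        next
          case False
          have "v \<notin> e x" if "x \<in> T" for x
            using e[OF that] False C by (auto simp: clutter_def)
          then show ?thesis
            by (simp add: sum.neutral)
        qed
      qed
      then show ?thesis
        unfolding ideal_power_edge_ideal[OF C] sp
        by (simp add: monomial_set_def single_in_carrier keys_exponents fin)
    qed
    ultimately show "\<exists>s\<in>carrier ?R - P. s \<otimes>\<^bsub>?R\<^esub> p \<in> ideal_power ?R (edge_ideal C) i"
      by auto
  qed
  \<comment> \<open>Normal torsion-freeness speaks of \<open>1 \<le> i\<close> only; packing no
    edges is trivial.\<close>
  then have "p \<in> monomial_set (verts C) (packs (edges C) i)" if "1 \<le> i"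
    using ntf that ideal_power_edge_ideal[OF C] unfolding normally_torsion_free_def by blast
  then have "packs (edges C) i (Poly_Mapping.lookup (exponents (verts C) m))" if "1 \<le> i"
    using that by (simp add: monomial_set_def p_def)
  moreover have "Poly_Mapping.lookup (exponents (verts C) m) v \<le> m v" for v
    by (simp add: lookup_exponents fin)
  ultimately have "packs (edges C) i m" if "1 \<le> i"
    using that packs_mono by blast
  then show "packs (edges C) i m"
    by (cases i) auto
qed

text \<open>Powers lie in symbolic powers with witness 1. Conversely, a witness at the prime of a
  minimal cover bounds the weight of each monomial of \<open>r\<close> on that cover from below by
  \<open>i\<close>, and the packing property turns these bounds into a packing.\<close>

lemma normally_torsion_free_if_packing_property:
  assumes C: "clutter C" and pack: "packing_property C"
  shows "normally_torsion_free (polynomial_ring (verts C) :: ('v, 'k::field) mpoly ring)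
    (edge_ideal C)"
proof -
  let ?R = "polynomial_ring (verts C) :: ('v, 'k) mpoly ring"
  have fin: "finite T" if "vertex_cover C T" for T
    using vertex_cover_finite[OF C that] .
  have "r \<in> symbolic_power ?R (edge_ideal C) i"
    if r: "r \<in> ideal_power ?R (edge_ideal C) i" for r i
  proof -
    have "1 \<in> carrier ?R - P" if P: "minimal_prime ?R (edge_ideal C) P" for P
    proof -
      obtain T where "P = cover_ideal (verts C) T"
        using iffD1[OF minimal_prime_edge_ideal_iff[OF C] P] by blast
      then show ?thesis
        by (auto simp: carrier_polynomial_ring monomial_set_def)
    qed
    then show ?thesis
      using r unfolding symbolic_power_def ideal_power_edge_ideal[OF C]
      by (auto simp: monomial_set_def intro!: bexI[of _ 1])
  qed
  moreover have "r \<in> ideal_power ?R (edge_ideal C) i"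
    if r: "r \<in> symbolic_power ?R (edge_ideal C) i" for r i
  proof -
    have "i \<le> sum (Poly_Mapping.lookup c) T"
      if c: "c \<in> Poly_Mapping.keys r" and T: "vertex_cover C T" for c T
    proof -
      \<comment> \<open>Witnesses are available only at minimal primes, so the bound is proved for a
        minimal cover inside \<open>T\<close>.\<close>
      obtain S where S: "minimal_cover C S" "S \<subseteq> T"
        using minimal_cover_subset[OF C T] .
      have cover: "vertex_cover C S"
        using S(1) by (simp add: minimal_cover_def)
      define w where "w a = sum (Poly_Mapping.lookup a) S" for a :: "'v \<Rightarrow>\<^sub>0 nat"
      have w_add: "w (a + b) = w a + w b" for a b
        by (simp add: w_def lookup_add sum.distrib)
      have "minimal_prime ?R (edge_ideal C) (cover_ideal (verts C) S)"
        using minimal_prime_edge_ideal_iff[OF C] S(1) by blast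
      then obtain s where s: "s \<in> carrier ?R" "s \<notin> cover_ideal (verts C) S"
        "s * r \<in> ideal_power ?R (edge_ideal C) i"
        using r unfolding symbolic_power_def by auto
      \<comment> \<open>A polynomial outside the prime has a monomial free of the variables of
        \<open>S\<close>. Multiplication by \<open>s\<close> therefore does not raise the least
        weight.\<close>
      then obtain d where d: "d \<in> Poly_Mapping.keys s" "w d = 0"
        by (auto simp: monomial_set_def w_def)
      have "s \<noteq> 0" "r \<noteq> 0"
        using c d by auto
      then obtain a b where ab: "a + b \<in> Poly_Mapping.keys (s * r)" "w a \<le> w d" "w b \<le> w c"
        using keys_mult_least_weight[of s r w] w_add c d(1) by metis
      have "packs (edges C) i (Poly_Mapping.lookup (a + b))"
        using s(3) ab(1) unfolding ideal_power_edge_ideal[OF C] by (simp add: monomial_set_def)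
      \<comment> \<open>Weak duality on \<open>S\<close>, applied to a monomial of
        \<open>s * r\<close> whose weight is at most that of \<open>c\<close>.\<close>
      then have "i \<le> w (a + b)"
        unfolding w_def using cover
        by (intro packs_le_sum_cover fin) (auto simp: vertex_cover_def)
      also have "\<dots> \<le> w c"
        using ab d(2) by (simp add: w_add)
      also have "\<dots> \<le> sum (Poly_Mapping.lookup c) T"
        unfolding w_def using S(2) fin[OF T] by (intro sum_mono2) auto
      finally show ?thesis .
    qed
    then have "packs (edges C) i (Poly_Mapping.lookup c)" if "c \<in> Poly_Mapping.keys r" for c
      using pack that by (simp add: packing_property_def)
    then show ?thesis
      using r unfolding ideal_power_edge_ideal[OF C]
      by (simp add: monomial_set_def symbolic_power_def)
  qed
  ultimately show ?thesis
    unfolding normally_torsion_free_def by blast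
qed

theorem corollary2p12:
  fixes C C' :: "'v hypergraph"
  assumes "initial_clutter C"
    and "parallelization C C'"
    and "normally_torsion_free (polynomial_ring (verts C) :: ('v, 'k::field) mpoly ring)
           (edge_ideal C)"
  shows "normally_torsion_free (polynomial_ring (verts C') :: ('v, 'k) mpoly ring)
           (edge_ideal C')"
proof -
  have C: "clutter C"
    using assms(1) by (simp add: initial_clutter_def)
  have "packing_property C'"
    using packing_property_if_normally_torsion_free[OF C assms(3)]
    by (rule packing_property_parallelization[OF assms(2) C])
  then show ?thesis
    using normally_torsion_free_if_packing_property clutter_parallelization[OF assms(2) C] by blast
qed

end
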